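(* Let $(X,\alpha,\leq,\wedge,\vee)$ be a $\mathbb Z_2$-decreasing lattice. Assume that $X$ is $\sigma$-monotonically conditionally complete and countably Dini. If $q:X\times X\to X$ is either an RS-order-preserving arithmetic mean or an LS-order-preserving harmonic mean (arithmetic and harmonic being understood with respect to $\alpha$), then $q$ is Babylonian.
   Context: All spaces are Hausdorff. An involution on a space $X$ is a continuous map $\alpha:X\to X$ with $\alpha\circ\alpha=1_X$. A topological lattice is a Hausdorff space $X$ with a lattice structure $(X,\leq,\wedge,\vee)$ such that $\wedge,\vee:X\times X\to X$ are continuous. A $\mathbb Z_2$-decreasing lattice $(X,\alpha,\leq,\wedge,\vee)$ is a topological lattice with an involution $\alpha:X\to X$ such that $x\leq y$ implies $\alpha(y)\leq\alpha(x)$. We write $x<y$ for $x\leq y$ and $x\neq y$. $X$ is $\sigma$-monotonically conditionally complete if every monotonically increasing sequence bounded from above has a supremum in $X$ and every monotonically decreasing sequence bounded from below has an infimum in $X$. $X$ is countably Dini if every monotonically increasing sequence in $X$ that has a supremum converges to its supremum. A mean on $X$ is a continuous map $q:X\times X\to X$ with $q(x,x)=x$ and $q(x,y)=q(y,x)$ for all $x,y$. A mean $q$ is order-preserving if $x\leq q(x,y)\leq y$ whenever $x\leq y$; an order-preserving mean is LS-order-preserving if $x<q(x,y)\leq y$ whenever $x<y$, and RS-order-preserving if $x\leq q(x,y)<y$ whenever $x<y$. Put $q^\alpha(x,y):=\alpha(q(\alpha(x),\alpha(y)))$. The mean $q$ is arithmetic with respect to $\alpha$ if $q^\alpha(x,y)\leq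 q(x,y)$ for all $x,y$, and harmonic with respect to $\alpha$ if $q(x,y)\leq q^\alpha(x,y)$ for all $x,y$. Define $a_n,h_n:X\times X\to X$ $(n\ge0)$ by $a_0(x,y)=x$, $h_0(x,y)=y$, $a_{n+1}(x,y)=q(a_n(x,y),h_n(x,y))$, $h_{n+1}(x,y)=q^\alpha(a_n(x,y),h_n(x,y))$. The mean $q$ is Babylonian if one of the sequences $(a_n)_{n\geq1}$, $(h_n)_{n\geq1}$ is monotonically increasing with respect to the pointwise order and the other is monotonically decreasing, and for every $x,y\in X$ the sequences $(a_n(x,y))$ and $(h_n(x,y))$ converge and have the same limit. *)

theory Defs
  imports "HOL-Analysis.Analysis" "HOL-Library.Lub_Glb"
begin

locale topological_lattice =
  fixes ty :: "'a::{t2_space, lattice} itself"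
  assumes continuous_inf: "continuous_on UNIV (\<lambda>(x::'a, y). inf x y)"
    and continuous_sup: "continuous_on UNIV (\<lambda>(x::'a, y). sup x y)"

definition involution :: "('a::topological_space \<Rightarrow> 'a) \<Rightarrow> bool" where
  "involution \<alpha> \<longleftrightarrow> continuous_on UNIV \<alpha> \<and> \<alpha> \<circ> \<alpha> = id"

locale Z2_decreasing_lattice = topological_lattice "TYPE('a::{t2_space, lattice})" +
  fixes \<alpha> :: "'a::{t2_space, lattice} \<Rightarrow> 'a"
  assumes involution: "involution \<alpha>"
    and decreasing: "x \<le> y \<Longrightarrow> \<alpha> y \<le> \<alpha> x"

definition sigma_monotonically_conditionally_complete :: "'a::order itself \<Rightarrow> bool" where
  "sigma_monotonically_conditionally_complete ty \<longleftrightarrow>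
     (\<forall>s :: nat \<Rightarrow> 'a. incseq s \<and> bdd_above (range s) \<longrightarrow> (\<exists>l. isLub UNIV (range s) l)) \<and>
     (\<forall>s :: nat \<Rightarrow> 'a. decseq s \<and> bdd_below (range s) \<longrightarrow> (\<exists>l. isGlb UNIV (range s) l))"

definition countably_Dini :: "'a::{topological_space, order} itself \<Rightarrow> bool" where
  "countably_Dini ty \<longleftrightarrow>
     (\<forall>(s :: nat \<Rightarrow> 'a) l. incseq s \<and> isLub UNIV (range s) l \<longrightarrow> s \<longlonglongrightarrow> l)"

definition mean :: "('a::topological_space \<Rightarrow> 'a \<Rightarrow> 'a) \<Rightarrow> bool" where
  "mean q \<longleftrightarrow> continuous_on UNIV (\<lambda>(x, y). q x y) \<and> (\<forall>x. q x x = x) \<and> (\<forall>x y. q x y = q y x)"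

definition order_preserving :: "('a::order \<Rightarrow> 'a \<Rightarrow> 'a) \<Rightarrow> bool" where
  "order_preserving q \<longleftrightarrow> (\<forall>x y. x \<le> y \<longrightarrow> x \<le> q x y \<and> q x y \<le> y)"

definition LS_order_preserving :: "('a::order \<Rightarrow> 'a \<Rightarrow> 'a) \<Rightarrow> bool" where
  "LS_order_preserving q \<longleftrightarrow>
     order_preserving q \<and> (\<forall>x y. x < y \<longrightarrow> x < q x y \<and> q x y \<le> y)"

definition RS_order_preserving :: "('a::order \<Rightarrow> 'a \<Rightarrow> 'a) \<Rightarrow> bool" where
  "RS_order_preserving q \<longleftrightarrow>
     order_preserving q \<and> (\<forall>x y. x < y \<longrightarrow> x \<le> q x y \<and> q x y < y)"

definition conjugate :: "('a \<Rightarrow> 'a) \<Rightarrow> ('a \<Rightarrow> 'a \<Rightarrow> 'a) \<Rightarrow> 'a \<Rightarrow> 'a \<Rightarrow> 'a" where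
  "conjugate \<alpha> q x y = \<alpha> (q (\<alpha> x) (\<alpha> y))"

definition arithmetic :: "('a::order \<Rightarrow> 'a) \<Rightarrow> ('a \<Rightarrow> 'a \<Rightarrow> 'a) \<Rightarrow> bool" where
  "arithmetic \<alpha> q \<longleftrightarrow> (\<forall>x y. conjugate \<alpha> q x y \<le> q x y)"

definition harmonic :: "('a::order \<Rightarrow> 'a) \<Rightarrow> ('a \<Rightarrow> 'a \<Rightarrow> 'a) \<Rightarrow> bool" where
  "harmonic \<alpha> q \<longleftrightarrow> (\<forall>x y. q x y \<le> conjugate \<alpha> q x y)"

fun a_seq h_seq :: "('a \<Rightarrow> 'a) \<Rightarrow> ('a \<Rightarrow> 'a \<Rightarrow> 'a) \<Rightarrow> nat \<Rightarrow> 'a \<Rightarrow> 'a \<Rightarrow> 'a" where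
  "a_seq \<alpha> q 0 x y = x"
| "h_seq \<alpha> q 0 x y = y"
| "a_seq \<alpha> q (Suc n) x y = q (a_seq \<alpha> q n x y) (h_seq \<alpha> q n x y)"
| "h_seq \<alpha> q (Suc n) x y = conjugate \<alpha> q (a_seq \<alpha> q n x y) (h_seq \<alpha> q n x y)"

(* Monotonicity is required from index 1 on only (hence the Suc) and refers to the
   order on 'a => 'a => 'a, which is the pointwise one. *)
definition Babylonian ::
  "('a::{topological_space, order} \<Rightarrow> 'a) \<Rightarrow> ('a \<Rightarrow> 'a \<Rightarrow> 'a) \<Rightarrow> bool" where
  "Babylonian \<alpha> q \<longleftrightarrow>
     (incseq (\<lambda>n. a_seq \<alpha> q (Suc n)) \<and> decseq (\<lambda>n. h_seq \<alpha> q (Suc n)) \<or>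
      incseq (\<lambda>n. h_seq \<alpha> q (Suc n)) \<and> decseq (\<lambda>n. a_seq \<alpha> q (Suc n))) \<and>
     (\<forall>x y. \<exists>l. (\<lambda>n. a_seq \<alpha> q n x y) \<longlonglongrightarrow> l \<and> (\<lambda>n. h_seq \<alpha> q n x y) \<longlonglongrightarrow> l)"

end

theory Submission
  imports Defs
begin

text \<open>
  Let \<open>q\<close> be arithmetic and RS-order-preserving. From index \<open>1\<close> on, \<open>h\<^sub>n \<le> a\<^sub>n\<close>, and since \<open>q\<close> and
  its conjugate both take values between comparable arguments, each step shrinks the order interval
  from \<open>h\<^sub>n\<close> to \<open>a\<^sub>n\<close>. So \<open>h\<close> increases and \<open>a\<close> decreases (\<open>nested_iterates\<close>). Completeness and
  the Dini property make \<open>h\<close> converge; applied to \<open>\<alpha> \<circ> a\<close>, which increases, they make \<open>a\<close>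
  converge as well. The limits satisfy \<open>H \<le> A\<close> (\<open>nested_sequences_converge\<close>), and by continuity
  \<open>A = q A H\<close>. If \<open>H < A\<close>, strictness on the right would give \<open>q A H < A\<close>; hence \<open>H = A\<close>.

  The harmonic case is the arithmetic one read through \<open>\<alpha>\<close>: conjugation exchanges the two
  classes of means, and replacing \<open>q\<close> by its conjugate while swapping the starting points
  exchanges the sequences \<open>a\<close> and \<open>h\<close>.
\<close>

lemma mean_commute: "mean q \<Longrightarrow> q x y = q y x"
  by (simp add: mean_def)

context Z2_decreasing_lattice
begin

lemma involution_involutive [simp]: "\<alpha> (\<alpha> x) = x"
  using involution by (simp add: involution_def pointfree_idE)

lemma continuous_involution: "continuous_on UNIV \<alpha>"
  using involution by (simp add: involution_def)

lemma involution_strict: "x < y \<Longrightarrow> \<alpha> y < \<alpha> x"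
  using decreasing[of x y] by (metis involution_involutive order.strict_iff_order)

lemma conjugate_conjugate: "conjugate \<alpha> (conjugate \<alpha> q) = q"
  by (simp add: conjugate_def fun_eq_iff)

lemma mean_conjugate:
  assumes "mean q"
  shows "mean (conjugate \<alpha> q)"
proof -
  have q: "continuous_on UNIV (\<lambda>(x, y). q x y)"
    using assms by (simp add: mean_def)
  have arg: "continuous_on UNIV (\<lambda>z. (\<alpha> (fst z), \<alpha> (snd z)))"
    by (intro continuous_on_Pair continuous_on_compose2[OF continuous_involution, of _ fst]
          continuous_on_compose2[OF continuous_involution, of _ snd]
          continuous_on_fst continuous_on_snd continuous_on_id) auto
  have "continuous_on UNIV (\<lambda>z. \<alpha> (q (\<alpha> (fst z)) (\<alpha> (snd z))))"
    using continuous_on_compose2[OF continuous_involution continuous_on_compose2[OF q arg]]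
    by simp
  then show ?thesis
    using assms by (simp add: mean_def conjugate_def case_prod_unfold)
qed

text \<open>
  Symmetry of \<open>q\<close> enters because \<open>\<alpha>\<close> reverses the order: a comparable pair \<open>x \<le> y\<close> is sent to a
  pair comparable the other way round.
\<close>

lemma order_preserving_conjugate:
  assumes "mean q" "order_preserving q"
  shows "order_preserving (conjugate \<alpha> q)"
  unfolding order_preserving_def
proof (intro allI impI)
  fix x y :: 'a
  assume "x \<le> y"
  then have "\<alpha> y \<le> q (\<alpha> x) (\<alpha> y) \<and> q (\<alpha> x) (\<alpha> y) \<le> \<alpha> x"
    using assms(2) decreasing[of x y] mean_commute[OF assms(1), of "\<alpha> x" "\<alpha> y"]
    by (simp add: order_preserving_def)
  then show "x \<le> conjugate \<alpha> q x y \<and> conjugate \<alpha> q x y \<le> y"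
    using decreasing[of "\<alpha> y"] decreasing[of _ "\<alpha> x"] by (simp add: conjugate_def)
qed

lemma RS_order_preserving_conjugate:
  assumes "mean q" "LS_order_preserving q"
  shows "RS_order_preserving (conjugate \<alpha> q)"
proof -
  have op: "order_preserving (conjugate \<alpha> q)"
    using assms order_preserving_conjugate by (simp add: LS_order_preserving_def)
  have "conjugate \<alpha> q x y < y" if "x < y" for x y
  proof -
    have "\<alpha> y < q (\<alpha> x) (\<alpha> y)"
      using assms(2) involution_strict[OF that] mean_commute[OF assms(1), of "\<alpha> x" "\<alpha> y"]
      by (simp add: LS_order_preserving_def)
    then show ?thesis
      using involution_strict[of "\<alpha> y"] by (simp add: conjugate_def)
  qed
  with op show ?thesis
    by (auto simp: RS_order_preserving_def order_preserving_def)
qed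

lemma arithmetic_conjugate: "harmonic \<alpha> q \<Longrightarrow> arithmetic \<alpha> (conjugate \<alpha> q)"
  by (simp add: arithmetic_def harmonic_def conjugate_conjugate)

text \<open>
  The starting points are swapped for the sake of index \<open>0\<close>; afterwards the symmetry of \<open>q\<close> and
  of its conjugate absorbs the swap.
\<close>

lemma a_h_seq_conjugate:
  assumes "mean q"
  shows "a_seq \<alpha> (conjugate \<alpha> q) n x y = h_seq \<alpha> q n y x \<and>
         h_seq \<alpha> (conjugate \<alpha> q) n x y = a_seq \<alpha> q n y x"
proof (induction n)
  case (Suc n)
  then show ?case
    using mean_commute[OF assms] mean_commute[OF mean_conjugate[OF assms]]
    by (simp only: a_seq.simps h_seq.simps conjugate_conjugate)
qed simp

lemma Babylonian_if_conjugate: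
  assumes "mean q" and B: "Babylonian \<alpha> (conjugate \<alpha> q)"
  shows "Babylonian \<alpha> q"
proof -
  have swap: "a_seq \<alpha> (conjugate \<alpha> q) = (\<lambda>n x y. h_seq \<alpha> q n y x)"
      "h_seq \<alpha> (conjugate \<alpha> q) = (\<lambda>n x y. a_seq \<alpha> q n y x)"
    using a_h_seq_conjugate[OF assms(1)] by (simp_all add: fun_eq_iff)
  have flip: "incseq (\<lambda>n x y. f n y x) \<longleftrightarrow> incseq f" "decseq (\<lambda>n x y. f n y x) \<longleftrightarrow> decseq f"
    for f :: "nat \<Rightarrow> 'a \<Rightarrow> 'a \<Rightarrow> 'a"
    unfolding incseq_Suc_iff decseq_Suc_iff unfolding le_fun_def by blast+
  show ?thesis
    using B
    unfolding Babylonian_def swap flip[of "\<lambda>n. a_seq \<alpha> q (Suc n)"]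
      flip[of "\<lambda>n. h_seq \<alpha> q (Suc n)"]
    by blast
qed

lemma nested_iterates:
  assumes "mean q" "order_preserving q" "arithmetic \<alpha> q"
  defines "a \<equiv> \<lambda>n x y. a_seq \<alpha> q (Suc n) x y" and "h \<equiv> \<lambda>n x y. h_seq \<alpha> q (Suc n) x y"
  shows "h n x y \<le> a n x y" and "a (Suc n) x y \<le> a n x y" and "h n x y \<le> h (Suc n) x y"
proof -
  show le: "h n x y \<le> a n x y"
    using assms(3) by (simp add: a_def h_def arithmetic_def)
  have "q (a n x y) (h n x y) \<le> a n x y"
    using le assms(2) mean_commute[OF assms(1), of "a n x y"] by (simp add: order_preserving_def)
  then show "a (Suc n) x y \<le> a n x y"
    by (simp add: a_def h_def)
  have "h n x y \<le> conjugate \<alpha> q (a n x y) (h n x y)"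
    using le order_preserving_conjugate[OF assms(1,2)]
      mean_commute[OF mean_conjugate[OF assms(1)], of "a n x y"]
    by (simp add: order_preserving_def)
  then show "h n x y \<le> h (Suc n) x y"
    by (simp add: a_def h_def)
qed

text \<open>
  The Dini property concerns increasing sequences only; \<open>\<alpha>\<close> turns the decreasing sequence into
  one of these, and \<open>A\<close> is the image under \<open>\<alpha>\<close> of the resulting supremum. Since every \<open>h n\<close> lies
  below every \<open>a m\<close>, comparing least upper bounds with upper bounds twice gives \<open>H \<le> A\<close>.
\<close>

lemma nested_sequences_converge:
  fixes a h :: "nat \<Rightarrow> 'a"
  assumes complete: "sigma_monotonically_conditionally_complete TYPE('a)"
    and Dini: "countably_Dini TYPE('a)"
    and a: "decseq a" and h: "incseq h" and le: "\<And>n. h n \<le> a n"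
  obtains H A where "h \<longlonglongrightarrow> H" "a \<longlonglongrightarrow> A" "H \<le> A"
proof -
  have cross: "h n \<le> a m" for n m
  proof -
    have "h n \<le> h (max n m)" using h by (simp add: incseq_def)
    also have "\<dots> \<le> a (max n m)" by (rule le)
    also have "\<dots> \<le> a m" using a by (simp add: decseq_def)
    finally show ?thesis .
  qed
  have inc: "incseq (\<lambda>n. \<alpha> (a n))"
    using a decreasing by (simp add: incseq_def decseq_def)
  have "bdd_above (range h)"
    using cross by (intro bdd_aboveI[of _ "a 0"]) auto
  then obtain H where H: "isLub UNIV (range h) H"
    using complete h by (auto simp: sigma_monotonically_conditionally_complete_def)
  have "bdd_above (range (\<lambda>n. \<alpha> (a n)))"
    using cross decreasing by (intro bdd_aboveI[of _ "\<alpha> (h 0)"]) auto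
  then obtain L where L: "isLub UNIV (range (\<lambda>n. \<alpha> (a n))) L"
    using complete inc by (auto simp: sigma_monotonically_conditionally_complete_def)
  have lim_h: "h \<longlonglongrightarrow> H"
    using Dini h H by (auto simp: countably_Dini_def)
  have "(\<lambda>n. \<alpha> (a n)) \<longlonglongrightarrow> L"
    using Dini inc L by (auto simp: countably_Dini_def)
  from continuous_on_tendsto_compose[OF continuous_involution this]
  have lim_a: "a \<longlonglongrightarrow> \<alpha> L"
    by simp
  have "H \<le> a m" for m
    using isLub_le_isUb[OF H] cross by (auto simp: isUb_def setle_def)
  then have "L \<le> \<alpha> H"
    using isLub_le_isUb[OF L] decreasing by (auto simp: isUb_def setle_def)
  then have "H \<le> \<alpha> L"
    using decreasing[of L "\<alpha> H"] by simp
  with lim_h lim_a show ?thesis by (rule that)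
qed

lemma Babylonian_if_RS_arithmetic:
  assumes complete: "sigma_monotonically_conditionally_complete TYPE('a)"
    and Dini: "countably_Dini TYPE('a)"
    and q: "mean q" "RS_order_preserving q" "arithmetic \<alpha> q"
  shows "Babylonian \<alpha> q"
proof -
  have op: "order_preserving q"
    using q by (simp add: RS_order_preserving_def)
  note nested = nested_iterates[OF q(1) op q(3)]
  have "\<exists>l. (\<lambda>n. a_seq \<alpha> q n x y) \<longlonglongrightarrow> l \<and> (\<lambda>n. h_seq \<alpha> q n x y) \<longlonglongrightarrow> l" for x y
  proof -
    define a where "a = (\<lambda>n. a_seq \<alpha> q (Suc n) x y)"
    define h where "h = (\<lambda>n. h_seq \<alpha> q (Suc n) x y)"
    have "decseq a" "incseq h" "\<And>n. h n \<le> a n"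
      unfolding decseq_Suc_iff incseq_Suc_iff a_def h_def using nested by blast+
    from nested_sequences_converge[OF complete Dini this]
    obtain H A where lim: "h \<longlonglongrightarrow> H" "a \<longlonglongrightarrow> A" and le: "H \<le> A" .
    have "continuous_on UNIV (\<lambda>(x, y). q x y)"
      using q(1) by (simp add: mean_def)
    from continuous_on_tendsto_compose[OF this tendsto_Pair[OF lim(2,1)]]
    have "(\<lambda>n. a (Suc n)) \<longlonglongrightarrow> q A H"
      by (simp add: a_def h_def)
    then have fixpoint: "q A H = A"
      using LIMSEQ_unique LIMSEQ_Suc[OF lim(2)] by blast
    have "H = A"
    proof (rule ccontr)
      assume "H \<noteq> A"
      with le have "q H A < A"
        using q(2) by (simp add: RS_order_preserving_def)
      with fixpoint q(1) show False
        by (simp add: mean_commute[of q H A])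
    qed
    then show ?thesis
      using lim LIMSEQ_imp_Suc[of "\<lambda>n. a_seq \<alpha> q n x y"] LIMSEQ_imp_Suc[of "\<lambda>n. h_seq \<alpha> q n x y"]
      unfolding a_def h_def by blast
  qed
  moreover have "incseq (\<lambda>n. h_seq \<alpha> q (Suc n)) \<and> decseq (\<lambda>n. a_seq \<alpha> q (Suc n))"
    unfolding incseq_Suc_iff decseq_Suc_iff unfolding le_fun_def using nested by blast
  ultimately show ?thesis
    by (simp only: Babylonian_def) blast
qed

end

theorem proposition4p13:
  fixes \<alpha> :: "'a::{t2_space, lattice} \<Rightarrow> 'a" and q :: "'a \<Rightarrow> 'a \<Rightarrow> 'a"
  assumes "Z2_decreasing_lattice \<alpha>"
    and "sigma_monotonically_conditionally_complete TYPE('a)"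
    and "countably_Dini TYPE('a)"
    and "mean q"
    and "RS_order_preserving q \<and> arithmetic \<alpha> q \<or> LS_order_preserving q \<and> harmonic \<alpha> q"
  shows "Babylonian \<alpha> q"
proof -
  interpret Z2_decreasing_lattice \<alpha> by fact
  from assms(5) show ?thesis
  proof
    assume "RS_order_preserving q \<and> arithmetic \<alpha> q"
    then show ?thesis
      using Babylonian_if_RS_arithmetic assms(2-4) by blast
  next
    assume "LS_order_preserving q \<and> harmonic \<alpha> q"
    then have "Babylonian \<alpha> (conjugate \<alpha> q)"
      using assms(2-4) mean_conjugate RS_order_preserving_conjugate arithmetic_conjugate
      by (intro Babylonian_if_RS_arithmetic) auto
    then show ?thesis
      by (rule Babylonian_if_conjugate[OF assms(4)])
  qed
qed

end
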